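(* For a matroid $\mathcal{M}$ the following conditions are equivalent: (a) $\mathcal{M}$ is LC[$2$]; (b) $\mathcal{M}$ is RZ[$2$]; (c) $\mathcal{M}$ is Rayleigh; (d) $\mathcal{M}$ is LC[$3$].
   Context: Let $\mathcal{M}$ be a matroid on a finite set $E$ with indeterminates $\mathbf{y}=\{y_c:c\in E\}$. For disjoint $I,J\subseteq E$, $M_I^J(\mathbf{y}):=\sum_B\prod_{c\in B\setminus I}y_c$, summed over bases $B$ with $I\subseteq B$, $B\cap J=\varnothing$. For distinct $e,f$: $\Delta M\{e,f\}:=M_e^fM_f^e-M_{ef}M^{ef}$; $\mathcal{M}$ is Rayleigh if $\Delta M\{e,f\}(\mathbf{y})\ge0$ for all distinct $e,f$ whenever all $y_c>0$. For $S\subseteq E$ and integer $j\ge0$, $M(S,j;\mathbf{y}):=\sum_B\prod_{c\in B}y_c$ over bases $B$ with $|B\cap S|=j$. For a positive integer $m$: $\mathcal{M}$ is RZ[$m$] if whenever all $y_c>0$, for every $S\subseteq E$ with $|S|\le m$ the polynomial $\sum_{j=0}^{|S|}M(S,j;\mathbf{y})x^j$ has only real zeros; $\mathcal{M}$ is LC[$m$] if whenever all $y_c>0$, for every $S\subseteq E$ with $|S|\le m$ the sequence $\big(\binom{|S|}{j}^{-1}M(S,j;\mathbf{y})\big)_{j=0}^{|S|}$ is logarithmically concave, i.e. $a_j^2\ge a_{j-1}a_{j+1}$ for $1\le j\le|S|-1$. *)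

theory Defs
  imports Complex_Main "HOL-Computational_Algebra.Polynomial"
begin

text \<open>Matroids are presented by their ground set and their set of bases.\<close>

locale matroid =
  fixes E :: "'a set" and \<B> :: "'a set set"
  assumes finite_ground: "finite E"
    and basis_subset: "B \<in> \<B> \<Longrightarrow> B \<subseteq> E"
    and bases_nonempty: "\<B> \<noteq> {}"
    and basis_exchange:
      "\<lbrakk>A \<in> \<B>; B \<in> \<B>; a \<in> A - B\<rbrakk> \<Longrightarrow> \<exists>b \<in> B - A. insert b (A - {a}) \<in> \<B>"

text \<open>
  The generating polynomials are given by their values at a real point \<open>y\<close>: they are only ever
  compared at points whose coordinates, indexed by the ground set, are positive.
  \<open>minor_gen \<B> I J y\<close> is $M_I^J(y)$; \<open>level_gen \<B> S j y\<close> is $M(S,j;y)$.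
\<close>

definition minor_gen :: "'a set set \<Rightarrow> 'a set \<Rightarrow> 'a set \<Rightarrow> ('a \<Rightarrow> real) \<Rightarrow> real" where
  "minor_gen \<B> I J y = (\<Sum>B | B \<in> \<B> \<and> I \<subseteq> B \<and> B \<inter> J = {}. \<Prod>c\<in>B - I. y c)"

definition rayleigh_diff :: "'a set set \<Rightarrow> 'a \<Rightarrow> 'a \<Rightarrow> ('a \<Rightarrow> real) \<Rightarrow> real" where
  "rayleigh_diff \<B> e f y =
     minor_gen \<B> {e} {f} y * minor_gen \<B> {f} {e} y - minor_gen \<B> {e, f} {} y * minor_gen \<B> {} {e, f} y"

definition rayleigh :: "'a set \<Rightarrow> 'a set set \<Rightarrow> bool" where
  "rayleigh E \<B> \<longleftrightarrow>
     (\<forall>y. (\<forall>c\<in>E. y c > 0) \<longrightarrow> (\<forall>e\<in>E. \<forall>f\<in>E. e \<noteq> f \<longrightarrow> rayleigh_diff \<B> e f y \<ge> 0))"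

definition level_gen :: "'a set set \<Rightarrow> 'a set \<Rightarrow> nat \<Rightarrow> ('a \<Rightarrow> real) \<Rightarrow> real" where
  "level_gen \<B> S j y = (\<Sum>B | B \<in> \<B> \<and> card (B \<inter> S) = j. \<Prod>c\<in>B. y c)"

definition level_poly :: "'a set set \<Rightarrow> 'a set \<Rightarrow> ('a \<Rightarrow> real) \<Rightarrow> real poly" where
  "level_poly \<B> S y = (\<Sum>j\<le>card S. monom (level_gen \<B> S j y) j)"

definition only_real_zeros :: "real poly \<Rightarrow> bool" where
  "only_real_zeros p \<longleftrightarrow> (\<forall>z::complex. poly (map_poly complex_of_real p) z = 0 \<longrightarrow> z \<in> \<real>)"

definition RZ :: "nat \<Rightarrow> 'a set \<Rightarrow> 'a set set \<Rightarrow> bool" where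
  "RZ m E \<B> \<longleftrightarrow>
     (\<forall>y. (\<forall>c\<in>E. y c > 0) \<longrightarrow> (\<forall>S. S \<subseteq> E \<and> card S \<le> m \<longrightarrow> only_real_zeros (level_poly \<B> S y)))"

definition log_concave_upto :: "nat \<Rightarrow> (nat \<Rightarrow> real) \<Rightarrow> bool" where
  "log_concave_upto n a \<longleftrightarrow> (\<forall>j. 1 \<le> j \<and> j < n \<longrightarrow> (a j)\<^sup>2 \<ge> a (j - 1) * a (j + 1))"

definition LC :: "nat \<Rightarrow> 'a set \<Rightarrow> 'a set set \<Rightarrow> bool" where
  "LC m E \<B> \<longleftrightarrow>
     (\<forall>y. (\<forall>c\<in>E. y c > 0) \<longrightarrow>
        (\<forall>S. S \<subseteq> E \<and> card S \<le> m \<longrightarrow>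
           log_concave_upto (card S) (\<lambda>j. level_gen \<B> S j y / real (card S choose j))))"

end

theory Submission
  imports Defs
begin

text \<open>
  For \<open>S = {e, f}\<close> both LC[2] and RZ[2] say that the discriminant
  $(y_e M_e^f + y_f M_f^e)^2 - 4 y_e y_f M_{ef} M^{ef}$ is nonnegative. By AM-GM this follows from
  $\Delta M\{e,f\} \ge 0$; conversely, as none of the four minors involves $y_e$ or $y_f$, one may
  choose $y_e \approx M_f^e$ and $y_f \approx M_e^f$, the equality case of AM-GM.
  For \<open>S = {e, f, g}\<close>, letting $y_g$ tend to $0$ and to $\infty$ in $\Delta M\{e,f\} \ge 0$ gives
  $M_e^{fg} M_f^{eg} \ge M_{ef}^g M^{efg}$ and $M_{eg}^f M_{fg}^e \ge M_{efg} M_g^{ef}$. Summing over the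
  three pairs and using $3(uv + uw + vw) \le (u + v + w)^2$ gives LC[3].
\<close>

section \<open>Real quadratics and an elementary inequality\<close>

text \<open>The constant coefficient is the limit as t tends to 0 from the right. Replacing t by 1/t
  and multiplying by the square of t reverses the coefficients, so the same limit reaches
  \<open>r\<close>.\<close>

lemma quadratic_nonneg_coeffs:
  fixes p q r :: real
  assumes "\<And>t. t > 0 \<Longrightarrow> p + q * t + r * t\<^sup>2 \<ge> 0"
  shows "p \<ge> 0" "r \<ge> 0"
proof -
  have "((\<lambda>t. p + q * t + r * t\<^sup>2) \<longlongrightarrow> p + q * 0 + r * 0\<^sup>2) (at_right 0)"
    by (intro tendsto_intros)
  moreover have "\<forall>\<^sub>F t in at_right 0. p + q * t + r * t\<^sup>2 \<ge> 0"
    using assms by (auto simp: eventually_at_right_field intro: exI[of _ 1])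
  ultimately show "p \<ge> 0"
    using tendsto_lowerbound by fastforce
  have "((\<lambda>t. p * t\<^sup>2 + q * t + r) \<longlongrightarrow> p * 0\<^sup>2 + q * 0 + r) (at_right 0)"
    by (intro tendsto_intros)
  moreover have "p * t\<^sup>2 + q * t + r \<ge> 0" if "t > 0" for t
  proof -
    have "p * t\<^sup>2 + q * t + r = t\<^sup>2 * (p + q * (1 / t) + r * (1 / t)\<^sup>2)"
      using that by (simp add: field_simps power2_eq_square)
    then show ?thesis
      using assms[of "1 / t"] that by simp
  qed
  then have "\<forall>\<^sub>F t in at_right 0. p * t\<^sup>2 + q * t + r \<ge> 0"
    by (auto simp: eventually_at_right_field intro: exI[of _ 1])
  ultimately show "r \<ge> 0"
    using tendsto_lowerbound by fastforce
qed

text \<open>The hypothesis excludes just the zero polynomial, which has discriminant 0 although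
  every complex number is a zero. The leading coefficient \<open>c\<close> may vanish, as happens
  for level polynomials of degree below 2.\<close>

lemma only_real_zeros_quadratic_iff:
  assumes "a \<noteq> 0 \<or> b \<noteq> 0 \<or> c \<noteq> 0"
  shows "only_real_zeros [:a, b, c:] \<longleftrightarrow> b\<^sup>2 \<ge> 4 * a * c"
proof
  assume real: "only_real_zeros [:a, b, c:]"
  show "b\<^sup>2 \<ge> 4 * a * c"
  proof (rule ccontr)
    assume "\<not> b\<^sup>2 \<ge> 4 * a * c"
    then have neg: "4 * a * c - b\<^sup>2 > 0"
      by simp
    have c: "c \<noteq> 0"
      using neg by (auto simp: not_less)
    define s where "s = sqrt (4 * a * c - b\<^sup>2)"
    have s: "s > 0" "s\<^sup>2 = 4 * a * c - b\<^sup>2"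
      using neg by (auto simp: s_def)
    \<comment> \<open>This is the root with \<open>s\<close> in the numerator given by the quadratic
      formula; it is not real because \<open>s\<close> is positive.\<close>
    define z where "z = Complex (- b / (2 * c)) (s / (2 * c))"
    have "2 * c * Re z = - b" "2 * c * Im z = s"
      using c by (simp_all add: z_def)
    then have "(2 * c * Re z)\<^sup>2 = b\<^sup>2" "(2 * c * Im z)\<^sup>2 = s\<^sup>2" and b: "b = - 2 * c * Re z"
      by simp_all
    then have "4 * c * (a + b * Re z + c * ((Re z)\<^sup>2 - (Im z)\<^sup>2)) = 0"
      using s(2) unfolding b by (simp add: algebra_simps power2_eq_square)
    then have "a + b * Re z + c * ((Re z)\<^sup>2 - (Im z)\<^sup>2) = 0"
      using c by simp
    moreover have "Im z * (b + 2 * c * Re z) = 0"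
      using b by simp
    ultimately have "poly (map_poly complex_of_real [:a, b, c:]) z = 0"
      by (simp add: map_poly_pCons complex_eq_iff algebra_simps power2_eq_square)
    then have "z \<in> \<real>"
      using real by (auto simp: only_real_zeros_def)
    then show False
      using s c by (simp add: z_def complex_is_Real_iff)
  qed
next
  assume disc: "b\<^sup>2 \<ge> 4 * a * c"
  show "only_real_zeros [:a, b, c:]"
    unfolding only_real_zeros_def
  proof (intro allI impI)
    fix z :: complex
    assume "poly (map_poly complex_of_real [:a, b, c:]) z = 0"
    then have re: "a + b * Re z + c * ((Re z)\<^sup>2 - (Im z)\<^sup>2) = 0"
      and im: "Im z * (b + 2 * c * Re z) = 0"
      by (auto simp: map_poly_pCons complex_eq_iff algebra_simps power2_eq_square)
    show "z \<in> \<real>"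
    proof (rule ccontr)
      assume "z \<notin> \<real>"
      then have y: "Im z \<noteq> 0"
        by (simp add: complex_is_Real_iff)
      \<comment> \<open>With \<open>Im z\<close> nonzero, the two parts of the equation determine
        \<open>b\<close> and \<open>a\<close> from \<open>c\<close> and \<open>z\<close>, and the
        discriminant becomes -4 times the square of \<open>c * Im z\<close>.\<close>
      then have b: "b = - 2 * c * Re z"
        using im by simp
      then have a: "a = c * ((Re z)\<^sup>2 + (Im z)\<^sup>2)"
        using re by (simp add: algebra_simps power2_eq_square)
      have "c \<noteq> 0"
        using assms a b by auto
      then have "(c * Im z)\<^sup>2 > 0"
        using y by simp
      moreover have "b\<^sup>2 - 4 * a * c = - 4 * (c * Im z)\<^sup>2"
        unfolding a b by (simp add: algebra_simps power2_eq_square)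
      ultimately show False
        using disc by linarith
    qed
  qed
qed

text \<open>The difference of the two sides is half the sum of the squares of the pairwise
  differences.\<close>

lemma three_pairwise_products_le_square:
  fixes u v w :: real
  shows "3 * (u * v + u * w + v * w) \<le> (u + v + w)\<^sup>2"
  using zero_le_power2[of "u - v"] zero_le_power2[of "u - w"] zero_le_power2[of "v - w"]
  by (simp add: algebra_simps power2_eq_square)

section \<open>Minors and level coefficients\<close>

text \<open>An element of \<open>I\<close> is removed from every product, and an element of
  \<open>J\<close> lies in no basis of the sum. Hence the weights of these elements can be chosen
  freely without changing the minor.\<close>

lemma minor_gen_fun_upd:
  assumes "g \<in> I \<union> J"
  shows "minor_gen \<B> I J (y(g := t)) = minor_gen \<B> I J y"
  unfolding minor_gen_def using assms by (intro sum.cong prod.cong) auto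

context matroid
begin

lemma finite_bases [simp]: "finite \<B>"
  using finite_subset[of \<B> "Pow E"] finite_ground basis_subset by auto

lemma finite_basis: "B \<in> \<B> \<Longrightarrow> finite B"
  using basis_subset finite_ground finite_subset by blast

lemma minor_gen_nonneg:
  assumes "\<forall>c\<in>E. y c > 0"
  shows "minor_gen \<B> I J y \<ge> 0"
  unfolding minor_gen_def using assms basis_subset
  by (intro sum_nonneg prod_nonneg) (auto intro!: less_imp_le)

text \<open>The bases are split by whether they contain \<open>g\<close>. With
  \<open>minor_gen_fun_upd\<close> this makes each minor affine in the weight of
  \<open>g\<close>.\<close>

lemma minor_gen_delete_contract:
  assumes "g \<notin> I \<union> J"
  shows "minor_gen \<B> I J y = minor_gen \<B> I (insert g J) y + y g * minor_gen \<B> (insert g I) J y"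
proof -
  let ?P = "\<lambda>B. B \<in> \<B> \<and> I \<subseteq> B \<and> B \<inter> J = {}"
  have "{B. ?P B} = {B. ?P B \<and> g \<notin> B} \<union> {B. ?P B \<and> g \<in> B}"
    by auto
  then have "minor_gen \<B> I J y =
      (\<Sum>B | ?P B \<and> g \<notin> B. \<Prod>c\<in>B - I. y c) + (\<Sum>B | ?P B \<and> g \<in> B. \<Prod>c\<in>B - I. y c)"
    unfolding minor_gen_def by (subst sum.union_disjoint[symmetric]) auto
  also have "(\<Sum>B | ?P B \<and> g \<notin> B. \<Prod>c\<in>B - I. y c) = minor_gen \<B> I (insert g J) y"
    unfolding minor_gen_def by (intro sum.cong) auto
  also have "(\<Sum>B | ?P B \<and> g \<in> B. \<Prod>c\<in>B - I. y c) = (\<Sum>B | ?P B \<and> g \<in> B. y g * (\<Prod>c\<in>B - insert g I. y c))"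
  proof (intro sum.cong refl)
    fix B assume "B \<in> {B. ?P B \<and> g \<in> B}"
    then have "finite (B - I)" "g \<in> B - I"
      using assms finite_basis by auto
    moreover have "B - I - {g} = B - insert g I"
      by auto
    ultimately show "(\<Prod>c\<in>B - I. y c) = y g * (\<Prod>c\<in>B - insert g I. y c)"
      by (simp add: prod.remove)
  qed
  also have "\<dots> = y g * minor_gen \<B> (insert g I) J y"
    unfolding minor_gen_def sum_distrib_left by (intro sum.cong) auto
  finally show ?thesis .
qed

text \<open>The bases are grouped by their trace \<open>I\<close> on \<open>S\<close>, and the
  weight of each basis factors into the part on \<open>I\<close> and the part outside it.\<close>

lemma level_gen_eq_sum_minor_gen:
  assumes "S \<subseteq> E"
  shows "level_gen \<B> S j y = (\<Sum>I | I \<subseteq> S \<and> card I = j. (\<Prod>c\<in>I. y c) * minor_gen \<B> I (S - I) y)"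
proof -
  have S: "finite S"
    using assms finite_ground finite_subset by blast
  have "level_gen \<B> S j y =
      (\<Sum>I | I \<subseteq> S \<and> card I = j. \<Sum>B | B \<in> {B \<in> \<B>. card (B \<inter> S) = j} \<and> B \<inter> S = I. \<Prod>c\<in>B. y c)"
    unfolding level_gen_def
    by (rule sum.group[symmetric]) (use S in auto)
  also have "\<dots> = (\<Sum>I | I \<subseteq> S \<and> card I = j. (\<Prod>c\<in>I. y c) * minor_gen \<B> I (S - I) y)"
  proof (intro sum.cong refl)
    fix I assume I: "I \<in> {I. I \<subseteq> S \<and> card I = j}"
    have "(\<Sum>B | B \<in> {B \<in> \<B>. card (B \<inter> S) = j} \<and> B \<inter> S = I. \<Prod>c\<in>B. y c)
        = (\<Sum>B | B \<in> \<B> \<and> I \<subseteq> B \<and> B \<inter> (S - I) = {}. (\<Prod>c\<in>I. y c) * (\<Prod>c\<in>B - I. y c))"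
    proof (intro sum.cong)
      show "{B. B \<in> {B \<in> \<B>. card (B \<inter> S) = j} \<and> B \<inter> S = I}
          = {B. B \<in> \<B> \<and> I \<subseteq> B \<and> B \<inter> (S - I) = {}}"
      proof -
        have "B \<inter> S = I \<longleftrightarrow> I \<subseteq> B \<and> B \<inter> (S - I) = {}" for B
          using I by auto
        from this[symmetric] show ?thesis
          using I by auto
      qed
      fix B assume "B \<in> {B. B \<in> \<B> \<and> I \<subseteq> B \<and> B \<inter> (S - I) = {}}"
      then show "(\<Prod>c\<in>B. y c) = (\<Prod>c\<in>I. y c) * (\<Prod>c\<in>B - I. y c)"
        using prod.subset_diff[of I B y] finite_basis by (simp add: mult.commute)
    qed
    then show "(\<Sum>B | B \<in> {B \<in> \<B>. card (B \<inter> S) = j} \<and> B \<inter> S = I. \<Prod>c\<in>B. y c)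
        = (\<Prod>c\<in>I. y c) * minor_gen \<B> I (S - I) y"
      by (simp add: minor_gen_def sum_distrib_left)
  qed
  finally show ?thesis .
qed

lemma level_gen_eq_0:
  assumes "S \<subseteq> E" "card S < j"
  shows "level_gen \<B> S j y = 0"
proof -
  have "finite S"
    using assms finite_ground finite_subset by blast
  then have "card (B \<inter> S) \<noteq> j" for B
    using assms card_mono[of S "B \<inter> S"] by auto
  then show ?thesis
    by (simp add: level_gen_def)
qed

text \<open>Summing over all levels counts each basis once, and there is at least one basis. So the
  level coefficients do not all vanish, as the quadratic criterion for real zeros demands.\<close>

lemma sum_level_gen_pos:
  assumes y: "\<forall>c\<in>E. y c > 0" and "S \<subseteq> E" "card S \<le> m"
  shows "(\<Sum>j\<le>m. level_gen \<B> S j y) > 0"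
proof -
  have "card (B \<inter> S) \<le> m" for B
    using assms card_mono[of S "B \<inter> S"] finite_subset[OF _ finite_ground] by fastforce
  then have "(\<Sum>j\<le>m. level_gen \<B> S j y) = (\<Sum>B\<in>\<B>. \<Prod>c\<in>B. y c)"
    unfolding level_gen_def by (intro sum.group[where T = "{..m}"]) auto
  also have "\<dots> > 0"
    using y bases_nonempty basis_subset by (intro sum_pos prod_pos) auto
  finally show ?thesis .
qed

section \<open>RZ[2] and LC[2] as one discriminant condition\<close>

lemma RZ_2_iff_discriminant:
  "RZ 2 E \<B> \<longleftrightarrow>
    (\<forall>y. (\<forall>c\<in>E. y c > 0) \<longrightarrow> (\<forall>S. S \<subseteq> E \<and> card S \<le> 2 \<longrightarrow>
      (level_gen \<B> S 1 y)\<^sup>2 \<ge> 4 * level_gen \<B> S 0 y * level_gen \<B> S 2 y))"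
proof -
  have "only_real_zeros (level_poly \<B> S y) \<longleftrightarrow>
      (level_gen \<B> S 1 y)\<^sup>2 \<ge> 4 * level_gen \<B> S 0 y * level_gen \<B> S 2 y"
    if y: "\<forall>c\<in>E. y c > 0" and S: "S \<subseteq> E" "card S \<le> 2" for y S
  proof -
    \<comment> \<open>Padding with zero coefficients treats all \<open>S\<close> with at most two
      elements as quadratics.\<close>
    have "level_poly \<B> S y = (\<Sum>j\<le>2. monom (level_gen \<B> S j y) j)"
      unfolding level_poly_def
      using S level_gen_eq_0[OF S(1)] by (intro sum.mono_neutral_left) auto
    also have "\<dots> = [:level_gen \<B> S 0 y, level_gen \<B> S 1 y, level_gen \<B> S 2 y:]"
      by (simp add: numeral_2_eq_2 monom_Suc monom_0)
    finally have poly: "level_poly \<B> S y = \<dots>" .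
    show ?thesis
      unfolding poly using sum_level_gen_pos[OF y S]
      by (intro only_real_zeros_quadratic_iff) (auto simp: numeral_2_eq_2)
  qed
  then show ?thesis
    unfolding RZ_def by blast
qed

text \<open>For two elements the only index is 1, and the binomials 1, 2, 1 produce the factor 4.
  For smaller \<open>S\<close> log-concavity is vacuous, while level 2 vanishes and the discriminant
  is a square.\<close>

lemma LC_2_iff_discriminant:
  "LC 2 E \<B> \<longleftrightarrow>
    (\<forall>y. (\<forall>c\<in>E. y c > 0) \<longrightarrow> (\<forall>S. S \<subseteq> E \<and> card S \<le> 2 \<longrightarrow>
      (level_gen \<B> S 1 y)\<^sup>2 \<ge> 4 * level_gen \<B> S 0 y * level_gen \<B> S 2 y))"
proof -
  have "log_concave_upto (card S) (\<lambda>j. level_gen \<B> S j y / real (card S choose j)) \<longleftrightarrow>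
      (level_gen \<B> S 1 y)\<^sup>2 \<ge> 4 * level_gen \<B> S 0 y * level_gen \<B> S 2 y"
    if S: "S \<subseteq> E" "card S \<le> 2" for y S
  proof (cases "card S = 2")
    case True
    have "1 \<le> j \<and> j < (2::nat) \<longleftrightarrow> j = 1" for j
      by auto
    then show ?thesis
      using True by (simp add: log_concave_upto_def power_divide numeral_2_eq_2 field_simps)
  next
    case False
    then show ?thesis
      using S level_gen_eq_0[of S 2 y] by (auto simp: log_concave_upto_def)
  qed
  then show ?thesis
    unfolding LC_def by blast
qed

section \<open>Level coefficients of pairs and triples\<close>

lemma level_gen_pair:
  assumes "e \<in> E" "f \<in> E" "e \<noteq> f"
  shows "level_gen \<B> {e, f} 0 y = minor_gen \<B> {} {e, f} y"
    "level_gen \<B> {e, f} 1 y = y e * minor_gen \<B> {e} {f} y + y f * minor_gen \<B> {f} {e} y"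
    "level_gen \<B> {e, f} 2 y = y e * y f * minor_gen \<B> {e, f} {} y"
proof -
  have "{I. I \<subseteq> {e, f} \<and> card I = j} = {I \<in> {{}, {e}, {f}, {e, f}}. card I = j}" for j
    by blast
  then have subsets: "{I. I \<subseteq> {e, f} \<and> card I = 0} = {{}}" "{I. I \<subseteq> {e, f} \<and> card I = 1} = {{e}, {f}}"
    "{I. I \<subseteq> {e, f} \<and> card I = 2} = {{e, f}}"
    using assms(3) by auto
  have "{e, f} - {e} = {f}" "{e, f} - {f} = {e}"
    using assms(3) by auto
  then show "level_gen \<B> {e, f} 0 y = minor_gen \<B> {} {e, f} y"
    "level_gen \<B> {e, f} 1 y = y e * minor_gen \<B> {e} {f} y + y f * minor_gen \<B> {f} {e} y"
    "level_gen \<B> {e, f} 2 y = y e * y f * minor_gen \<B> {e, f} {} y"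
    using assms by (simp_all only: level_gen_eq_sum_minor_gen subsets insert_subset empty_subsetI) auto
qed

lemma level_gen_triple:
  assumes "e \<in> E" "f \<in> E" "g \<in> E" "e \<noteq> f" "e \<noteq> g" "f \<noteq> g"
  shows "level_gen \<B> {e, f, g} 0 y = minor_gen \<B> {} {e, f, g} y"
    "level_gen \<B> {e, f, g} 1 y =
      y e * minor_gen \<B> {e} {f, g} y + y f * minor_gen \<B> {f} {e, g} y + y g * minor_gen \<B> {g} {e, f} y"
    "level_gen \<B> {e, f, g} 2 y =
      y e * y f * minor_gen \<B> {e, f} {g} y + y e * y g * minor_gen \<B> {e, g} {f} y
      + y f * y g * minor_gen \<B> {f, g} {e} y"
    "level_gen \<B> {e, f, g} 3 y = y e * y f * y g * minor_gen \<B> {e, f, g} {} y"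
proof -
  have "Pow {e, f, g} = {{}, {e}, {f}, {g}, {e, f}, {e, g}, {f, g}, {e, f, g}}"
    by (simp add: Pow_insert insert_commute)
  \<comment> \<open>This rule filters the explicit list of subsets one entry at a time, so that
    simplification only has to compute cardinalities.\<close>
  moreover have filter_insert:
    "{I \<in> insert A \<A>. P I} = (if P A then insert A {I \<in> \<A>. P I} else {I \<in> \<A>. P I})"
    for A :: "'a set" and \<A> P
    by auto
  ultimately have Pow_filter: "{I. I \<subseteq> {e, f, g} \<and> card I = j}
      = {I \<in> {{}, {e}, {f}, {g}, {e, f}, {e, g}, {f, g}, {e, f, g}}. card I = j}" for j
    by blast
  have subsets: "{I. I \<subseteq> {e, f, g} \<and> card I = 0} = {{}}"
    "{I. I \<subseteq> {e, f, g} \<and> card I = 1} = {{e}, {f}, {g}}"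
    "{I. I \<subseteq> {e, f, g} \<and> card I = 2} = {{e, f}, {e, g}, {f, g}}"
    "{I. I \<subseteq> {e, f, g} \<and> card I = 3} = {{e, f, g}}"
    unfolding Pow_filter filter_insert using assms(4-6) by simp_all
  \<comment> \<open>The complements become the excluded sets of the minors; the inequations keep the
    three pairs as separate summands.\<close>
  have "{e, f, g} - {e} = {f, g}" "{e, f, g} - {f} = {e, g}" "{e, f, g} - {g} = {e, f}"
    "{e, f, g} - {e, f} = {g}" "{e, f, g} - {e, g} = {f}" "{e, f, g} - {f, g} = {e}"
    "{e, f} \<noteq> {e, g}" "{e, f} \<noteq> {f, g}" "{e, g} \<noteq> {f, g}"
    using assms(4-6) by auto
  then show "level_gen \<B> {e, f, g} 0 y = minor_gen \<B> {} {e, f, g} y"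
    "level_gen \<B> {e, f, g} 1 y =
      y e * minor_gen \<B> {e} {f, g} y + y f * minor_gen \<B> {f} {e, g} y + y g * minor_gen \<B> {g} {e, f} y"
    "level_gen \<B> {e, f, g} 2 y =
      y e * y f * minor_gen \<B> {e, f} {g} y + y e * y g * minor_gen \<B> {e, g} {f} y
      + y f * y g * minor_gen \<B> {f, g} {e} y"
    "level_gen \<B> {e, f, g} 3 y = y e * y f * y g * minor_gen \<B> {e, f, g} {} y"
    using assms by (simp_all only: level_gen_eq_sum_minor_gen subsets insert_subset empty_subsetI) auto
qed

section \<open>Equivalence of LC[2] and the Rayleigh property\<close>

lemma rayleigh_imp_LC_2:
  assumes "rayleigh E \<B>"
  shows "LC 2 E \<B>"
  unfolding LC_2_iff_discriminant
proof (intro allI impI, elim conjE)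
  fix y :: "'a \<Rightarrow> real" and S
  assume y: "\<forall>c\<in>E. y c > 0" and S: "S \<subseteq> E" "card S \<le> 2"
  show "(level_gen \<B> S 1 y)\<^sup>2 \<ge> 4 * level_gen \<B> S 0 y * level_gen \<B> S 2 y"
  proof (cases "card S = 2")
    case True
    then obtain e f where ef: "S = {e, f}" "e \<noteq> f"
      by (auto simp: card_2_iff)
    then have E: "e \<in> E" "f \<in> E"
      using S by auto
    define p q where "p = minor_gen \<B> {e} {f} y" "q = minor_gen \<B> {f} {e} y"
    have "4 * (y e * y f) * (minor_gen \<B> {e, f} {} y * minor_gen \<B> {} {e, f} y) \<le> 4 * (y e * y f) * (p * q)"
      using assms y E ef(2) unfolding rayleigh_def rayleigh_diff_def p_q_def
      by (intro mult_left_mono) (auto intro!: mult_nonneg_nonneg less_imp_le)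
    also have "\<dots> \<le> (y e * p + y f * q)\<^sup>2"
      using zero_le_power2[of "y e * p - y f * q"] by (simp add: algebra_simps power2_eq_square)
    finally show ?thesis
      unfolding ef(1) level_gen_pair[OF E ef(2)] p_q_def by (simp add: algebra_simps)
  next
    case False
    then show ?thesis
      using S level_gen_eq_0[of S 2 y] by simp
  qed
qed

lemma LC_2_imp_rayleigh:
  assumes "LC 2 E \<B>"
  shows "rayleigh E \<B>"
  unfolding rayleigh_def
proof (intro allI ballI impI)
  fix y :: "'a \<Rightarrow> real" and e f
  assume y: "\<forall>c\<in>E. y c > 0" and E: "e \<in> E" "f \<in> E" and ef: "e \<noteq> f"
  define p q r where "p = minor_gen \<B> {e} {f} y" "q = minor_gen \<B> {f} {e} y"
    "r = minor_gen \<B> {e, f} {} y * minor_gen \<B> {} {e, f} y"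
  have nonneg: "p \<ge> 0" "q \<ge> 0"
    by (simp_all add: p_q_r_def minor_gen_nonneg[OF y])
  \<comment> \<open>\<open>p\<close> or \<open>q\<close> may vanish, hence the shift by \<open>t\<close>.\<close>
  have bound: "(p + t) * (q + t) \<ge> r" if t: "t > 0" for t
  proof -
    define z where "z = y(e := q + t, f := p + t)"
    have z: "z e = q + t" "z f = p + t"
      using ef by (auto simp: z_def)
    have "\<forall>c\<in>E. z c > 0"
      using y nonneg t by (auto simp: z_def)
    then have "(level_gen \<B> {e, f} 1 z)\<^sup>2 \<ge> 4 * level_gen \<B> {e, f} 0 z * level_gen \<B> {e, f} 2 z"
      using assms E ef unfolding LC_2_iff_discriminant by (auto simp: card_insert_if)
    then have "(z e * p + z f * q)\<^sup>2 \<ge> 4 * (z e * z f) * r"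
      unfolding level_gen_pair[OF E ef]
      by (simp add: z_def p_q_r_def minor_gen_fun_upd algebra_simps)
    \<comment> \<open>Enlarging \<open>p\<close> and \<open>q\<close> by \<open>t\<close> makes both
      summands equal to \<open>z e * z f\<close>. After squaring, one factor
      \<open>z e * z f\<close> cancels and the bound on \<open>r\<close> remains.\<close>
    moreover have "z e * p + z f * q \<le> 2 * ((q + t) * (p + t))"
      using nonneg t by (simp add: z algebra_simps)
    then have "(z e * p + z f * q)\<^sup>2 \<le> (2 * ((q + t) * (p + t)))\<^sup>2"
      using nonneg t by (intro power_mono) (auto simp: z)
    ultimately have "((q + t) * (p + t)) * r \<le> ((q + t) * (p + t)) * ((q + t) * (p + t))"
      by (simp add: z power2_eq_square)
    moreover have "(q + t) * (p + t) > 0"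
      using nonneg t by simp
    ultimately show ?thesis
      by (metis mult.commute mult_le_cancel_left_pos)
  qed
  \<comment> \<open>This lets \<open>t\<close> tend to 0: \<open>p * q - r\<close> is the constant
    coefficient of \<open>(p + t) * (q + t) - r\<close>.\<close>
  have "p * q - r \<ge> 0"
    by (rule quadratic_nonneg_coeffs(1)[of _ "p + q" 1])
      (use bound in \<open>simp add: algebra_simps power2_eq_square\<close>)
  then show "rayleigh_diff \<B> e f y \<ge> 0"
    by (simp add: rayleigh_diff_def p_q_r_def)
qed

section \<open>From the Rayleigh property to LC[3]\<close>

text \<open>As a function of the weight of \<open>g\<close>, the Rayleigh difference of
  \<open>e\<close> and \<open>f\<close> is a quadratic that is nonnegative on the positive axis. Its
  outer coefficients are the analogous differences with \<open>g\<close> excluded from, respectively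
  included in, all bases.\<close>

lemma rayleigh_minor_gen_triple:
  assumes "rayleigh E \<B>" and y: "\<forall>c\<in>E. y c > 0"
    and E: "e \<in> E" "f \<in> E" and ne: "e \<noteq> f" "e \<noteq> g" "f \<noteq> g"
  shows "minor_gen \<B> {e, f} {g} y * minor_gen \<B> {} {e, f, g} y
      \<le> minor_gen \<B> {e} {f, g} y * minor_gen \<B> {f} {e, g} y" (is "?r0 * ?s0 \<le> ?p0 * ?q0")
    and "minor_gen \<B> {e, f, g} {} y * minor_gen \<B> {g} {e, f} y
      \<le> minor_gen \<B> {e, g} {f} y * minor_gen \<B> {f, g} {e} y" (is "?r1 * ?s1 \<le> ?p1 * ?q1")
proof -
  have quad: "(?p0 * ?q0 - ?r0 * ?s0) + (?p0 * ?q1 + ?p1 * ?q0 - ?r0 * ?s1 - ?r1 * ?s0) * t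
      + (?p1 * ?q1 - ?r1 * ?s1) * t\<^sup>2 \<ge> 0" if t: "t > 0" for t
  proof -
    have "rayleigh_diff \<B> e f (y(g := t)) \<ge> 0"
      using assms t by (auto simp: rayleigh_def)
    moreover have "minor_gen \<B> {e} {f} (y(g := t)) = ?p0 + t * ?p1"
      "minor_gen \<B> {f} {e} (y(g := t)) = ?q0 + t * ?q1"
      "minor_gen \<B> {e, f} {} (y(g := t)) = ?r0 + t * ?r1"
      "minor_gen \<B> {} {e, f} (y(g := t)) = ?s0 + t * ?s1"
      using ne by (subst minor_gen_delete_contract[of g];
          auto simp: minor_gen_fun_upd insert_commute)+
    ultimately show ?thesis
      by (simp add: rayleigh_diff_def algebra_simps power2_eq_square)
  qed
  show "?r0 * ?s0 \<le> ?p0 * ?q0" "?r1 * ?s1 \<le> ?p1 * ?q1"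
    using quadratic_nonneg_coeffs[OF quad] by simp_all
qed

lemma rayleigh_imp_LC_3:
  assumes ray: "rayleigh E \<B>"
  shows "LC 3 E \<B>"
  unfolding LC_def
proof (intro allI impI, elim conjE)
  fix y :: "'a \<Rightarrow> real" and S
  assume y: "\<forall>c\<in>E. y c > 0" and S: "S \<subseteq> E" "card S \<le> 3"
  show "log_concave_upto (card S) (\<lambda>j. level_gen \<B> S j y / real (card S choose j))"
  proof (cases "card S = 3")
    case True
    then obtain e f g where efg: "S = {e, f, g}" and ne: "e \<noteq> f" "e \<noteq> g" "f \<noteq> g"
      by (auto simp: card_3_iff)
    then have E: "e \<in> E" "f \<in> E" "g \<in> E"
      using S by auto
    \<comment> \<open>The summands of level 1 are \<open>u\<close>, \<open>v\<close>,
      \<open>w\<close>, for \<open>e\<close>, \<open>f\<close>, \<open>g\<close>. Their primed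
      partners are the summands of level 2 that omit the same element.\<close>
    define u v w where "u = y e * minor_gen \<B> {e} {f, g} y" "v = y f * minor_gen \<B> {f} {e, g} y"
      "w = y g * minor_gen \<B> {g} {e, f} y"
    define u' v' w' where "u' = y f * y g * minor_gen \<B> {f, g} {e} y"
      "v' = y e * y g * minor_gen \<B> {e, g} {f} y" "w' = y e * y f * minor_gen \<B> {e, f} {g} y"
    define a b where "a = minor_gen \<B> {} {e, f, g} y" "b = y e * y f * y g * minor_gen \<B> {e, f, g} {} y"
    have level: "level_gen \<B> S 0 y = a" "level_gen \<B> S 1 y = u + v + w"
      "level_gen \<B> S 2 y = u' + v' + w'" "level_gen \<B> S 3 y = b"
      unfolding efg level_gen_triple[OF E ne] by (simp_all add: u_v_w_def u'_v'_w'_def a_b_def)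
    note pos = y[rule_format, OF E(1)] y[rule_format, OF E(2)] y[rule_format, OF E(3)]
    note ef = rayleigh_minor_gen_triple[OF ray y E(1,2) ne]
    note eg = rayleigh_minor_gen_triple[OF ray y E(1,3) ne(2,1) ne(3)[symmetric]]
    note fg = rayleigh_minor_gen_triple[OF ray y E(2,3) ne(3) ne(1)[symmetric] ne(2)[symmetric]]
    note scaled = mult_left_mono[OF _ less_imp_le[OF mult_pos_pos]]
    \<comment> \<open>Each inequality with the third element excluded is multiplied by the weights
      of its pair.\<close>
    have low: "w' * a \<le> u * v" "v' * a \<le> u * w" "u' * a \<le> v * w"
      using scaled[OF ef(1) pos(1,2)] scaled[OF eg(1) pos(1,3)] scaled[OF fg(1) pos(2,3)]
      by (simp_all add: u_v_w_def u'_v'_w'_def a_b_def insert_commute algebra_simps)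
    \<comment> \<open>With the third element included, its weight is needed twice, once for each of
      the two level 2 summands on the right.\<close>
    have high: "b * w \<le> u' * v'" "b * v \<le> u' * w'" "b * u \<le> v' * w'"
      using scaled[OF ef(2) mult_pos_pos[OF pos(1,3)] mult_pos_pos[OF pos(2,3)]]
        scaled[OF eg(2) mult_pos_pos[OF pos(1,2)] mult_pos_pos[OF pos(2,3)]]
        scaled[OF fg(2) mult_pos_pos[OF pos(1,2)] mult_pos_pos[OF pos(1,3)]]
      by (simp_all add: u_v_w_def u'_v'_w'_def a_b_def insert_commute algebra_simps)
    \<comment> \<open>Adding the three inequalities bounds \<open>a * (u' + v' + w')\<close> by the
      sum of pairwise products of \<open>u\<close>, \<open>v\<close>, \<open>w\<close>, hence by a
      third of the square of their sum. The divisors 3 are the middle binomials.\<close>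
    have "((u + v + w) / 3)\<^sup>2 \<ge> a * ((u' + v' + w') / 3)"
      using low three_pairwise_products_le_square[of u v w] by (simp add: power_divide algebra_simps)
    then have 1: "(level_gen \<B> S 1 y / real (3 choose 1))\<^sup>2
        \<ge> level_gen \<B> S 0 y / real (3 choose 0) * (level_gen \<B> S 2 y / real (3 choose 2))"
      unfolding level by (simp add: numeral_eq_Suc)
    have "((u' + v' + w') / 3)\<^sup>2 \<ge> (u + v + w) / 3 * b"
      using high three_pairwise_products_le_square[of u' v' w'] by (simp add: power_divide algebra_simps)
    then have 2: "(level_gen \<B> S 2 y / real (3 choose 2))\<^sup>2
        \<ge> level_gen \<B> S 1 y / real (3 choose 1) * (level_gen \<B> S 3 y / real (3 choose 3))"
      unfolding level by (simp add: numeral_eq_Suc)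
    show ?thesis
      unfolding log_concave_upto_def True
    proof (intro allI impI)
      fix j :: nat assume "1 \<le> j \<and> j < 3"
      then consider "j = 1" | "j = 2"
        by linarith
      then show "(level_gen \<B> S j y / real (3 choose j))\<^sup>2
          \<ge> level_gen \<B> S (j - 1) y / real (3 choose (j - 1)) * (level_gen \<B> S (j + 1) y / real (3 choose (j + 1)))"
        by cases (use 1 2 in \<open>simp_all add: numeral_eq_Suc\<close>)
    qed
  next
    case False
    then have "card S \<le> 2"
      using S by simp
    then show ?thesis
      using rayleigh_imp_LC_2[OF ray] S y by (simp add: LC_def)
  qed
qed

end

theorem theorem4p8:
  fixes E :: "'a set" and \<B> :: "'a set set"
  assumes "matroid E \<B>"
  shows "(LC 2 E \<B> \<longleftrightarrow> RZ 2 E \<B>) \<and> (RZ 2 E \<B> \<longleftrightarrow> rayleigh E \<B>) \<and> (rayleigh E \<B> \<longleftrightarrow> LC 3 E \<B>)"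
proof -
  interpret matroid E \<B>
    by (fact assms)
  have "LC 2 E \<B> \<longleftrightarrow> RZ 2 E \<B>"
    unfolding LC_2_iff_discriminant RZ_2_iff_discriminant ..
  moreover have "LC 2 E \<B>" if "LC 3 E \<B>"
    using that by (simp add: LC_def)
  \<comment> \<open>The implications close the cycle from Rayleigh to LC[3] to LC[2] and back to
    Rayleigh.\<close>
  ultimately show ?thesis
    using rayleigh_imp_LC_2 LC_2_imp_rayleigh rayleigh_imp_LC_3 by blast
qed

end
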